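(* For every closed computation $M$ of $\lambda_c^u$: $M$ converges (i.e. $M\Downarrow V$ for some closed value $V$) if and only if there is a computation type $\tau$ with $\tau\neq_{\mathsf C}\omega_{\mathsf C}$ such that $\vdash M:\tau$ is derivable with the empty basis.
   Context: Syntax of $\lambda_c^u$: values $V ::= x\mid \lambda x.M$, computations $M ::= \mathit{unit}\,V\mid M\star V$; $M[V/x]$ is capture-avoiding substitution. Convergence $\Downarrow$ is the least relation between closed computations and closed values such that $\mathit{unit}\,V\Downarrow V$, and if $M\Downarrow V$ and $N[V/x]\Downarrow W$ then $M\star\lambda x.N\Downarrow W$. Types: value types $\delta ::= \alpha\mid \delta\to\tau\mid \delta\wedge\delta\mid \omega_{\mathsf V}$ ($\alpha$ ranging over a countable set of type variables) and computation types $\tau ::= T\delta\mid \tau\wedge\tau\mid \omega_{\mathsf C}$. The preorders $\le_{\mathsf V}$ on value types and $\le_{\mathsf C}$ on computation types are the least preorders such that, for each sort, $\omega$ is the top, $\wedge$ is monotone, idempotent and commutative, $\sigma\wedge\sigma'\le\sigma$, and $\sigma\le\sigma',\sigma\le\sigma''$ imply $\sigma\le\sigma'\wedge\sigma''$; moreover $\omega_{\mathsf V}\le_{\mathsf V}\omega_{\mathsf V}\to\omega_{\mathsf C}$, $(\delta\to\tau)\wedge(\delta\to\tau')\le_{\mathsf V}\delta\to(\tau\wedge\tau')$, $\delta'\le_{\mathsf V}\delta$ and $\tau\le_{\mathsf C}\tau'$ imply $\delta\to\tau\le_{\mathsf V}\delta'\to\tau'$, $T\delta\wedge T\delta'\le_{\mathsf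 C}T(\delta\wedge\delta')$, and $\delta\le_{\mathsf V}\delta'$ implies $T\delta\le_{\mathsf C}T\delta'$. $\tau =_{\mathsf C}\tau'$ means $\tau\le_{\mathsf C}\tau'$ and $\tau'\le_{\mathsf C}\tau$. A basis $\Gamma$ is a finite set $\{x_1:\delta_1,\dots,x_n:\delta_n\}$ with distinct variables; $\Gamma,x:\delta$ denotes extension with $x$ not already in $\Gamma$. Typing rules: (Ax) $x:\delta\in\Gamma \Rightarrow \Gamma\vdash x:\delta$; ($\to$I) $\Gamma,x:\delta\vdash M:\tau\Rightarrow\Gamma\vdash\lambda x.M:\delta\to\tau$; (unit I) $\Gamma\vdash V:\delta\Rightarrow\Gamma\vdash\mathit{unit}\,V:T\delta$; ($\to$E) $\Gamma\vdash M:T\delta$ and $\Gamma\vdash V:\delta\to\tau$ $\Rightarrow \Gamma\vdash M\star V:\tau$; and, for both values (with $\omega_{\mathsf V},\le_{\mathsf V}$) and computations (with $\omega_{\mathsf C},\le_{\mathsf C}$): ($\omega$) $\Gamma\vdash P:\omega$; ($\wedge$I) $\Gamma\vdash P:\sigma$ and $\Gamma\vdash P:\sigma'$ give $\Gamma\vdash P:\sigma\wedge\sigma'$; ($\le$) $\Gamma\vdash P:\sigma$ and $\sigma\le\sigma'$ give $\Gamma\vdash P:\sigma'$. *)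

theory Defs
  imports Main
begin

text \<open>
  Terms are taken up to renaming of bound variables: variables are de Bruijn indices, and
  \<open>Lam\<close> binds index 0 of its body.
\<close>

datatype val = Var nat | Lam comp
  and comp = Unit val | Bind comp val  (infixl "\<star>" 70)

primrec fv_val :: "val \<Rightarrow> nat set" and fv_comp :: "comp \<Rightarrow> nat set" where
  "fv_val (Var i) = {i}"
| "fv_val (Lam M) = {i. Suc i \<in> fv_comp M}"
| "fv_comp (Unit V) = fv_val V"
| "fv_comp (M \<star> V) = fv_comp M \<union> fv_val V"

definition closed_val :: "val \<Rightarrow> bool" where
  "closed_val V \<longleftrightarrow> fv_val V = {}"

definition closed_comp :: "comp \<Rightarrow> bool" where
  "closed_comp M \<longleftrightarrow> fv_comp M = {}"

primrec lift_val :: "nat \<Rightarrow> val \<Rightarrow> val" and lift_comp :: "nat \<Rightarrow> comp \<Rightarrow> comp" where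
  "lift_val k (Var i) = Var (if i < k then i else Suc i)"
| "lift_val k (Lam M) = Lam (lift_comp (Suc k) M)"
| "lift_comp k (Unit V) = Unit (lift_val k V)"
| "lift_comp k (M \<star> V) = lift_comp k M \<star> lift_val k V"

text \<open>
  Substitution for index \<open>k\<close> also removes that index from the scope, so the indices above
  \<open>k\<close> are decremented. Hence \<open>N[V/x]\<close>, for the body \<open>N\<close> of an abstraction, is
  \<open>subst_comp 0 V N\<close>.
\<close>

primrec subst_val :: "nat \<Rightarrow> val \<Rightarrow> val \<Rightarrow> val"
  and subst_comp :: "nat \<Rightarrow> val \<Rightarrow> comp \<Rightarrow> comp" where
  "subst_val k W (Var i) = (if i < k then Var i else if i = k then W else Var (i - 1))"
| "subst_val k W (Lam M) = Lam (subst_comp (Suc k) (lift_val 0 W) M)"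
| "subst_comp k W (Unit V) = Unit (subst_val k W V)"
| "subst_comp k W (M \<star> V) = subst_comp k W M \<star> subst_val k W V"

inductive converges :: "comp \<Rightarrow> val \<Rightarrow> bool"  (infix "\<Down>" 50) where
  conv_unit: "closed_val V \<Longrightarrow> Unit V \<Down> V"
| conv_bind: "closed_comp (M \<star> Lam N) \<Longrightarrow> M \<Down> V \<Longrightarrow> subst_comp 0 V N \<Down> W \<Longrightarrow> M \<star> Lam N \<Down> W"

datatype vtype =
    TVar nat
  | Arr vtype ctype  (infixr "\<rightarrow>" 65)
  | InterV vtype vtype  (infixr "\<and>\<^sub>V" 70)
  | OmegaV  ("\<omega>\<^sub>V")
  and ctype =
    T vtype
  | InterC ctype ctype  (infixr "\<and>\<^sub>C" 70)
  | OmegaC  ("\<omega>\<^sub>C")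

inductive le_V :: "vtype \<Rightarrow> vtype \<Rightarrow> bool"  (infix "\<le>\<^sub>V" 50)
  and le_C :: "ctype \<Rightarrow> ctype \<Rightarrow> bool"  (infix "\<le>\<^sub>C" 50) where
  V_refl: "\<delta> \<le>\<^sub>V \<delta>"
| V_trans: "\<delta> \<le>\<^sub>V \<delta>' \<Longrightarrow> \<delta>' \<le>\<^sub>V \<delta>'' \<Longrightarrow> \<delta> \<le>\<^sub>V \<delta>''"
| V_top: "\<delta> \<le>\<^sub>V \<omega>\<^sub>V"
| V_mono: "\<delta>\<^sub>1 \<le>\<^sub>V \<delta>\<^sub>1' \<Longrightarrow> \<delta>\<^sub>2 \<le>\<^sub>V \<delta>\<^sub>2' \<Longrightarrow> \<delta>\<^sub>1 \<and>\<^sub>V \<delta>\<^sub>2 \<le>\<^sub>V \<delta>\<^sub>1' \<and>\<^sub>V \<delta>\<^sub>2'"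
| V_idem: "\<delta> \<le>\<^sub>V \<delta> \<and>\<^sub>V \<delta>"
| V_comm: "\<delta> \<and>\<^sub>V \<delta>' \<le>\<^sub>V \<delta>' \<and>\<^sub>V \<delta>"
| V_lower: "\<delta> \<and>\<^sub>V \<delta>' \<le>\<^sub>V \<delta>"
| V_greatest: "\<delta> \<le>\<^sub>V \<delta>' \<Longrightarrow> \<delta> \<le>\<^sub>V \<delta>'' \<Longrightarrow> \<delta> \<le>\<^sub>V \<delta>' \<and>\<^sub>V \<delta>''"
| V_omega_arr: "\<omega>\<^sub>V \<le>\<^sub>V \<omega>\<^sub>V \<rightarrow> \<omega>\<^sub>C"
| V_arr_inter: "(\<delta> \<rightarrow> \<tau>) \<and>\<^sub>V (\<delta> \<rightarrow> \<tau>') \<le>\<^sub>V \<delta> \<rightarrow> (\<tau> \<and>\<^sub>C \<tau>')"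
| V_arr: "\<delta>' \<le>\<^sub>V \<delta> \<Longrightarrow> \<tau> \<le>\<^sub>C \<tau>' \<Longrightarrow> \<delta> \<rightarrow> \<tau> \<le>\<^sub>V \<delta>' \<rightarrow> \<tau>'"
| C_refl: "\<tau> \<le>\<^sub>C \<tau>"
| C_trans: "\<tau> \<le>\<^sub>C \<tau>' \<Longrightarrow> \<tau>' \<le>\<^sub>C \<tau>'' \<Longrightarrow> \<tau> \<le>\<^sub>C \<tau>''"
| C_top: "\<tau> \<le>\<^sub>C \<omega>\<^sub>C"
| C_mono: "\<tau>\<^sub>1 \<le>\<^sub>C \<tau>\<^sub>1' \<Longrightarrow> \<tau>\<^sub>2 \<le>\<^sub>C \<tau>\<^sub>2' \<Longrightarrow> \<tau>\<^sub>1 \<and>\<^sub>C \<tau>\<^sub>2 \<le>\<^sub>C \<tau>\<^sub>1' \<and>\<^sub>C \<tau>\<^sub>2'"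
| C_idem: "\<tau> \<le>\<^sub>C \<tau> \<and>\<^sub>C \<tau>"
| C_comm: "\<tau> \<and>\<^sub>C \<tau>' \<le>\<^sub>C \<tau>' \<and>\<^sub>C \<tau>"
| C_lower: "\<tau> \<and>\<^sub>C \<tau>' \<le>\<^sub>C \<tau>"
| C_greatest: "\<tau> \<le>\<^sub>C \<tau>' \<Longrightarrow> \<tau> \<le>\<^sub>C \<tau>'' \<Longrightarrow> \<tau> \<le>\<^sub>C \<tau>' \<and>\<^sub>C \<tau>''"
| C_T_inter: "T \<delta> \<and>\<^sub>C T \<delta>' \<le>\<^sub>C T (\<delta> \<and>\<^sub>V \<delta>')"
| C_T: "\<delta> \<le>\<^sub>V \<delta>' \<Longrightarrow> T \<delta> \<le>\<^sub>C T \<delta>'"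

definition eq_C :: "ctype \<Rightarrow> ctype \<Rightarrow> bool"  (infix "=\<^sub>C" 50) where
  "\<tau> =\<^sub>C \<tau>' \<longleftrightarrow> \<tau> \<le>\<^sub>C \<tau>' \<and> \<tau>' \<le>\<^sub>C \<tau>"

text \<open>
  A basis is a list whose \<open>i\<close>-th entry is the type assumed for index \<open>i\<close>. Extending it with
  a fresh variable, on going under a binder, is consing: the old indices move up by one.
\<close>

type_synonym basis = "vtype list"

inductive typing_V :: "basis \<Rightarrow> val \<Rightarrow> vtype \<Rightarrow> bool"  ("_ \<turnstile>\<^sub>V _ : _" [51, 51, 51] 50)
  and typing_C :: "basis \<Rightarrow> comp \<Rightarrow> ctype \<Rightarrow> bool"  ("_ \<turnstile>\<^sub>C _ : _" [51, 51, 51] 50) where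
  Ax: "i < length \<Gamma> \<Longrightarrow> \<Gamma> ! i = \<delta> \<Longrightarrow> \<Gamma> \<turnstile>\<^sub>V Var i : \<delta>"
| ArrI: "\<delta> # \<Gamma> \<turnstile>\<^sub>C M : \<tau> \<Longrightarrow> \<Gamma> \<turnstile>\<^sub>V Lam M : \<delta> \<rightarrow> \<tau>"
| UnitI: "\<Gamma> \<turnstile>\<^sub>V V : \<delta> \<Longrightarrow> \<Gamma> \<turnstile>\<^sub>C Unit V : T \<delta>"
| ArrE: "\<Gamma> \<turnstile>\<^sub>C M : T \<delta> \<Longrightarrow> \<Gamma> \<turnstile>\<^sub>V V : \<delta> \<rightarrow> \<tau> \<Longrightarrow> \<Gamma> \<turnstile>\<^sub>C M \<star> V : \<tau>"
| OmegaV: "\<Gamma> \<turnstile>\<^sub>V V : \<omega>\<^sub>V"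
| InterV: "\<Gamma> \<turnstile>\<^sub>V V : \<delta> \<Longrightarrow> \<Gamma> \<turnstile>\<^sub>V V : \<delta>' \<Longrightarrow> \<Gamma> \<turnstile>\<^sub>V V : \<delta> \<and>\<^sub>V \<delta>'"
| SubV: "\<Gamma> \<turnstile>\<^sub>V V : \<delta> \<Longrightarrow> \<delta> \<le>\<^sub>V \<delta>' \<Longrightarrow> \<Gamma> \<turnstile>\<^sub>V V : \<delta>'"
| OmegaC: "\<Gamma> \<turnstile>\<^sub>C M : \<omega>\<^sub>C"
| InterC: "\<Gamma> \<turnstile>\<^sub>C M : \<tau> \<Longrightarrow> \<Gamma> \<turnstile>\<^sub>C M : \<tau>' \<Longrightarrow> \<Gamma> \<turnstile>\<^sub>C M : \<tau> \<and>\<^sub>C \<tau>'"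
| SubC: "\<Gamma> \<turnstile>\<^sub>C M : \<tau> \<Longrightarrow> \<tau> \<le>\<^sub>C \<tau>' \<Longrightarrow> \<Gamma> \<turnstile>\<^sub>C M : \<tau>'"

end

theory Submission
  imports Defs
begin

text \<open>
  Convergent computations are typable by subject expansion: if \<open>M\<close> converges to \<open>V\<close> and \<open>V\<close> has
  type \<open>\<delta>\<close>, then \<open>M\<close> has type \<open>T \<delta>\<close>, and \<open>\<omega>\<^sub>V\<close> types every value.
  Conversely, interpret value types as sets of closed values and computation types as sets of
  closed computations, where \<open>T \<delta>\<close> consists of the computations converging to a value in \<open>\<delta>\<close>.
  Typing is sound for this interpretation, and a type not above \<open>\<omega>\<^sub>C\<close> contains only convergent
  computations.
\<close>

section \<open>Closed terms and evaluation\<close>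

lemma lift_notin_fv:
  "fv_val V \<subseteq> {..<k} \<Longrightarrow> lift_val k V = V"
  "fv_comp M \<subseteq> {..<k} \<Longrightarrow> lift_comp k M = M"
proof (induction V and M arbitrary: k and k rule: val.induct comp.induct)
  case (Lam M)
  have "fv_comp M \<subseteq> {..<Suc k}"
  proof
    fix i assume "i \<in> fv_comp M"
    with Lam.prems show "i \<in> {..<Suc k}" by (cases i) auto
  qed
  with Lam.IH show ?case by simp
qed auto

lemma subst_notin_fv:
  "fv_val V \<subseteq> {..<k} \<Longrightarrow> subst_val k W V = V"
  "fv_comp M \<subseteq> {..<k} \<Longrightarrow> subst_comp k W M = M"
proof (induction V and M arbitrary: k W and k W rule: val.induct comp.induct)
  case (Lam M)
  have "fv_comp M \<subseteq> {..<Suc k}"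
  proof
    fix i assume "i \<in> fv_comp M"
    with Lam.prems show "i \<in> {..<Suc k}" by (cases i) auto
  qed
  with Lam.IH show ?case by simp
qed auto

lemma lift_closed [simp]: "closed_val V \<Longrightarrow> lift_val k V = V"
  by (simp add: closed_val_def lift_notin_fv)

lemma subst_closed [simp]: "closed_val V \<Longrightarrow> subst_val k W V = V"
  by (simp add: closed_val_def subst_notin_fv)

lemma closed_comp_simps [simp]:
  "closed_comp (Unit V) \<longleftrightarrow> closed_val V"
  "closed_comp (M \<star> V) \<longleftrightarrow> closed_comp M \<and> closed_val V"
  by (auto simp: closed_comp_def closed_val_def)

lemma closed_val_cases:
  assumes "closed_val V"
  obtains N where "V = Lam N"
  using assms by (cases V) (auto simp: closed_val_def)

inductive_cases converges_UnitE: "Unit V \<Down> W"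
inductive_cases converges_BindE: "M \<star> Lam N \<Down> W"

lemma converges_closed_val: "M \<Down> V \<Longrightarrow> closed_val V"
  by (induction rule: converges.induct)

lemma converges_deterministic: "M \<Down> V \<Longrightarrow> M \<Down> W \<Longrightarrow> W = V"
proof (induction arbitrary: W rule: converges.induct)
  case (conv_unit V)
  then show ?case by (auto elim: converges_UnitE)
next
  case (conv_bind M N V W)
  then show ?case by (metis converges_BindE)
qed

section \<open>Convergent computations are typable\<close>

text \<open>Since \<open>\<omega>\<close> types any term, free variables need not be in the basis; only those that are
  matter. The lemma covers strengthening as well as weakening.\<close>

lemma typing_mono_basis:
  "\<Gamma> \<turnstile>\<^sub>V V : \<delta> \<Longrightarrow>
    (\<And>i. i \<in> fv_val V \<Longrightarrow> i < length \<Gamma> \<Longrightarrow> i < length \<Gamma>' \<and> \<Gamma>' ! i \<le>\<^sub>V \<Gamma> ! i) \<Longrightarrow> \<Gamma>' \<turnstile>\<^sub>V V : \<delta>"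
  "\<Gamma> \<turnstile>\<^sub>C M : \<tau> \<Longrightarrow>
    (\<And>i. i \<in> fv_comp M \<Longrightarrow> i < length \<Gamma> \<Longrightarrow> i < length \<Gamma>' \<and> \<Gamma>' ! i \<le>\<^sub>V \<Gamma> ! i) \<Longrightarrow> \<Gamma>' \<turnstile>\<^sub>C M : \<tau>"
proof (induction arbitrary: \<Gamma>' and \<Gamma>' rule: typing_V_typing_C.inducts)
  case (Ax i \<Gamma> \<delta>)
  then show ?case by (metis fv_val.simps(1) insertI1 typing_V_typing_C.Ax SubV)
next
  case (ArrI \<delta> \<Gamma> M \<tau>)
  have "\<delta> # \<Gamma>' \<turnstile>\<^sub>C M : \<tau>"
  proof (rule ArrI.IH)
    fix i assume "i \<in> fv_comp M" "i < length (\<delta> # \<Gamma>)"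
    then show "i < length (\<delta> # \<Gamma>') \<and> (\<delta> # \<Gamma>') ! i \<le>\<^sub>V (\<delta> # \<Gamma>) ! i"
      using ArrI.prems by (cases i) (auto intro: V_refl)
  qed
  then show ?case by (rule typing_V_typing_C.ArrI)
next
  case (ArrE \<Gamma> M \<delta> V \<tau>)
  then show ?case by (auto intro!: typing_V_typing_C.ArrE)
qed (auto intro: typing_V_typing_C.intros)

section \<open>Subject expansion\<close>

lemma typing_closed_val: "\<Gamma> \<turnstile>\<^sub>V V : \<delta> \<Longrightarrow> closed_val V \<Longrightarrow> [] \<turnstile>\<^sub>V V : \<delta>"
  by (rule typing_mono_basis) (auto simp: closed_val_def)

lemma V_lower2: "\<delta> \<and>\<^sub>V \<delta>' \<le>\<^sub>V \<delta>'"
  using V_comm V_lower V_trans by blast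

text \<open>Subderivations may ask for different types of the substituted variable; strengthening
  the last assumption to their intersection lets them share one basis.\<close>

lemma basis_last_mono:
  assumes "\<delta>' \<le>\<^sub>V \<delta>"
  shows "\<Delta> @ [\<delta>] \<turnstile>\<^sub>V V : \<epsilon> \<Longrightarrow> \<Delta> @ [\<delta>'] \<turnstile>\<^sub>V V : \<epsilon>"
    and "\<Delta> @ [\<delta>] \<turnstile>\<^sub>C M : \<tau> \<Longrightarrow> \<Delta> @ [\<delta>'] \<turnstile>\<^sub>C M : \<tau>"
  using assms by (auto elim!: typing_mono_basis simp: nth_append intro: V_refl)

text \<open>A closed \<open>W\<close> is not a variable, and decremented indices are at least
  \<open>k\<close>, so neither can produce \<open>Var i\<close>.\<close>

lemma subst_eq_Var:
  assumes "closed_val W" "Var i = subst_val k W V" "i < k"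
  shows "V = Var i"
  using assms by (cases V) (auto simp: closed_val_def split: if_splits)

text \<open>By induction on the given derivation; the witness collects, as an intersection, the
  types at which copies of \<open>W\<close> are used. The substituted variable is the last entry of
  the basis, so consing under a binder keeps it last, at index
  \<open>length \<Delta>\<close>.\<close>

lemma typing_subst_expansion:
  assumes W: "closed_val W"
  shows
  "\<Delta> \<turnstile>\<^sub>V U : \<epsilon> \<Longrightarrow> U = subst_val (length \<Delta>) W V \<Longrightarrow>
    \<exists>\<delta>. [] \<turnstile>\<^sub>V W : \<delta> \<and> \<Delta> @ [\<delta>] \<turnstile>\<^sub>V V : \<epsilon>"
  "\<Delta> \<turnstile>\<^sub>C P : \<tau> \<Longrightarrow> P = subst_comp (length \<Delta>) W M \<Longrightarrow>
    \<exists>\<delta>. [] \<turnstile>\<^sub>V W : \<delta> \<and> \<Delta> @ [\<delta>] \<turnstile>\<^sub>C M : \<tau>"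
proof (induction arbitrary: V and M rule: typing_V_typing_C.inducts)
  case (Ax i \<Gamma> \<delta>)
  then have "V = Var i" using subst_eq_Var W by blast
  \<comment> \<open>No copy of \<open>W\<close> is involved here, so \<open>\<omega>\<^sub>V\<close>
    serves as witness.\<close>
  moreover have "\<Gamma> @ [\<omega>\<^sub>V] \<turnstile>\<^sub>V Var i : \<delta>"
    using Ax.hyps by (auto intro!: typing_V_typing_C.Ax simp: nth_append)
  ultimately show ?case using OmegaV by blast
next
  case (ArrI \<delta> \<Gamma> N \<tau>)
  show ?case
  proof (cases V)
    \<comment> \<open>The abstraction is the copy of \<open>W\<close> itself: its own type is the
      witness, and closedness of \<open>W\<close> moves the typing to the empty basis.\<close>
    case (Var j)
    with ArrI.prems have j: "j = length \<Gamma>" and N: "W = Lam N"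
      by (auto split: if_splits)
    have "[] \<turnstile>\<^sub>V W : \<delta> \<rightarrow> \<tau>"
      using typing_closed_val[OF typing_V_typing_C.ArrI[OF ArrI.hyps]] W N by blast
    moreover have "\<Gamma> @ [\<delta> \<rightarrow> \<tau>] \<turnstile>\<^sub>V V : \<delta> \<rightarrow> \<tau>"
      using Var j by (auto intro!: typing_V_typing_C.Ax)
    ultimately show ?thesis by blast
  next
    case (Lam M)
    with ArrI.prems W have "N = subst_comp (length (\<delta> # \<Gamma>)) W M" by simp
    from ArrI.IH[OF this] Lam show ?thesis
      by (auto intro: typing_V_typing_C.ArrI)
  qed
next
  case (UnitI \<Gamma> U \<delta>)
  then obtain V where V: "M = Unit V" "U = subst_val (length \<Gamma>) W V" by (cases M) auto
  from UnitI.IH[OF V(2)] V(1) show ?case by (auto intro: typing_V_typing_C.UnitI)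
next
  case (ArrE \<Gamma> P \<delta> U \<tau>)
  then obtain N V where V: "M = N \<star> V" "P = subst_comp (length \<Gamma>) W N" "U = subst_val (length \<Gamma>) W V"
    by (cases M) auto
  \<comment> \<open>The witness is the intersection of the two types found for
    \<open>W\<close>.\<close>
  from ArrE.IH(1)[OF V(2)] ArrE.IH(2)[OF V(3)] V(1) show ?case
    by (meson basis_last_mono V_lower V_lower2 typing_V_typing_C.ArrE typing_V_typing_C.InterV)
next
  case (OmegaV \<Gamma> U)
  then show ?case using typing_V_typing_C.OmegaV by blast
next
  case (InterV \<Gamma> U \<delta> \<delta>')
  from InterV.IH(1)[OF InterV.prems] InterV.IH(2)[OF InterV.prems] show ?case
    by (meson basis_last_mono V_lower V_lower2 typing_V_typing_C.InterV)
next
  case (SubV \<Gamma> U \<delta> \<delta>')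
  then show ?case using typing_V_typing_C.SubV by blast
next
  case (OmegaC \<Gamma> P)
  then show ?case using typing_V_typing_C.OmegaC typing_V_typing_C.OmegaV by blast
next
  case (InterC \<Gamma> P \<tau> \<tau>')
  from InterC.IH(1)[OF InterC.prems] InterC.IH(2)[OF InterC.prems] show ?case
    by (meson basis_last_mono V_lower V_lower2 typing_V_typing_C.InterV typing_V_typing_C.InterC)
next
  case (SubC \<Gamma> P \<tau> \<tau>')
  then show ?case using typing_V_typing_C.SubC by blast
qed

text \<open>The type \<open>\<delta>\<close> varies in the induction because, in the
  \<open>conv_bind\<close> case, the hypothesis for \<open>M\<close> is applied at the type that
  substitution expansion finds for \<open>V\<close>.\<close>

lemma subject_expansion: "M \<Down> V \<Longrightarrow> [] \<turnstile>\<^sub>V V : \<delta> \<Longrightarrow> [] \<turnstile>\<^sub>C M : T \<delta>"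
proof (induction arbitrary: \<delta> rule: converges.induct)
  case (conv_unit V)
  then show ?case by (blast intro: UnitI)
next
  case (conv_bind M N V W)
  then have "[] \<turnstile>\<^sub>C subst_comp 0 V N : T \<delta>" by blast
  then obtain \<epsilon> where V: "[] \<turnstile>\<^sub>V V : \<epsilon>" and N: "[\<epsilon>] \<turnstile>\<^sub>C N : T \<delta>"
    using typing_subst_expansion(2)[OF converges_closed_val[OF conv_bind.hyps(2)]] by fastforce
  from conv_bind.IH(1)[OF V] ArrI[OF N] show ?case by (rule ArrE)
qed

section \<open>Separating the types \<open>T \<delta>\<close> from
  \<open>\<omega>\<^sub>C\<close>\<close>

primrec omega_like :: "ctype \<Rightarrow> bool" where
  "omega_like (T \<delta>) \<longleftrightarrow> False"
| "omega_like (\<tau> \<and>\<^sub>C \<tau>') \<longleftrightarrow> omega_like \<tau> \<and> omega_like \<tau>'"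
| "omega_like \<omega>\<^sub>C \<longleftrightarrow> True"

text \<open>The rules that introduce \<open>T\<close> on the right also have it on the left. The
  resulting invariant holds of \<open>\<omega>\<^sub>C\<close> and fails for
  \<open>T \<delta>\<close>.\<close>

lemma omega_like_mono:
  "\<delta> \<le>\<^sub>V \<delta>' \<Longrightarrow> True"
  "\<tau> \<le>\<^sub>C \<tau>' \<Longrightarrow> omega_like \<tau> \<Longrightarrow> omega_like \<tau>'"
  by (induction rule: le_V_le_C.inducts) auto

lemma T_not_omega: "\<not> T \<delta> =\<^sub>C \<omega>\<^sub>C"
  using omega_like_mono(2)[of "\<omega>\<^sub>C" "T \<delta>"] by (auto simp: eq_C_def)

section \<open>Typable computations converge\<close>

text \<open>A logical predicate. Values have no application of their own, so an arrow type tests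
  \<open>V\<close> through \<open>Unit W \<star> V\<close>.\<close>

primrec sem_V :: "vtype \<Rightarrow> val \<Rightarrow> bool" and sem_C :: "ctype \<Rightarrow> comp \<Rightarrow> bool" where
  "sem_V (TVar a) = closed_val"
| "sem_V (\<delta> \<rightarrow> \<tau>) = (\<lambda>V. closed_val V \<and> (\<forall>W. sem_V \<delta> W \<longrightarrow> sem_C \<tau> (Unit W \<star> V)))"
| "sem_V (\<delta> \<and>\<^sub>V \<delta>') = (\<lambda>V. sem_V \<delta> V \<and> sem_V \<delta>' V)"
| "sem_V \<omega>\<^sub>V = closed_val"
| "sem_C (T \<delta>) = (\<lambda>M. closed_comp M \<and> (\<exists>V. M \<Down> V \<and> sem_V \<delta> V))"
| "sem_C (\<tau> \<and>\<^sub>C \<tau>') = (\<lambda>M. sem_C \<tau> M \<and> sem_C \<tau>' M)"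
| "sem_C \<omega>\<^sub>C = closed_comp"

lemma sem_closed:
  "sem_V \<delta> V \<Longrightarrow> closed_val V"
  "sem_C \<tau> M \<Longrightarrow> closed_comp M"
  by (induction \<delta> and \<tau> rule: vtype.induct ctype.induct) auto

text \<open>If both components of an intersection lie above \<open>\<omega>\<^sub>C\<close>, so does
  the intersection; otherwise one component already yields convergence.\<close>

lemma sem_C_converges: "sem_C \<tau> M \<Longrightarrow> (\<exists>V. M \<Down> V) \<or> \<omega>\<^sub>C \<le>\<^sub>C \<tau>"
proof (induction \<tau> rule: ctype.induct[where ?P1.0 = "\<lambda>_. True"])
  case (InterC \<tau> \<tau>')
  then show ?case by (auto intro: C_greatest)
qed (auto intro: C_refl)

text \<open>Membership of a closed computation depends only on the values it converges to. This
  gives closure under expansion.\<close>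

lemma sem_C_transfer:
  assumes "closed_comp Q" and "\<And>W. P \<Down> W \<Longrightarrow> Q \<Down> W"
  shows "sem_C \<tau> P \<Longrightarrow> sem_C \<tau> Q"
  using assms by (induction \<tau> rule: ctype.induct[where ?P1.0 = "\<lambda>_. True"]) auto

lemma le_sound:
  "\<delta> \<le>\<^sub>V \<delta>' \<Longrightarrow> sem_V \<delta> V \<Longrightarrow> sem_V \<delta>' V"
  "\<tau> \<le>\<^sub>C \<tau>' \<Longrightarrow> sem_C \<tau> M \<Longrightarrow> sem_C \<tau>' M"
proof (induction arbitrary: V and M rule: le_V_le_C.inducts)
  \<comment> \<open>The two memberships provide two values; determinism identifies them.\<close>
  case (C_T_inter \<delta> \<delta>')
  then show ?case by (auto dest: converges_deterministic)
qed (auto dest: sem_closed)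

text \<open>Simultaneous substitution of \<open>Vs\<close> for the indices from \<open>k\<close> on. The entries of \<open>Vs\<close> are not
  lifted under binders, so this is meaningful for closed \<open>Vs\<close> only.\<close>

primrec psubst_val :: "nat \<Rightarrow> val list \<Rightarrow> val \<Rightarrow> val"
  and psubst_comp :: "nat \<Rightarrow> val list \<Rightarrow> comp \<Rightarrow> comp" where
  "psubst_val k Vs (Var i) =
    (if i < k then Var i else if i - k < length Vs then Vs ! (i - k) else Var (i - length Vs))"
| "psubst_val k Vs (Lam M) = Lam (psubst_comp (Suc k) Vs M)"
| "psubst_comp k Vs (Unit V) = Unit (psubst_val k Vs V)"
| "psubst_comp k Vs (M \<star> V) = psubst_comp k Vs M \<star> psubst_val k Vs V"

lemma psubst_Nil:
  "psubst_val k [] V = V"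
  "psubst_comp k [] M = M"
  by (induction V and M arbitrary: k and k rule: val.induct comp.induct) auto

text \<open>Relates the contractum of an abstraction under \<open>Vs\<close> to the extended list
  \<open>W # Vs\<close> needed by the induction hypothesis in soundness.\<close>

lemma subst_psubst:
  assumes "\<forall>V \<in> set (W # Vs). closed_val V"
  shows
  "subst_val k W (psubst_val (Suc k) Vs V) = psubst_val k (W # Vs) V"
  "subst_comp k W (psubst_comp (Suc k) Vs M) = psubst_comp k (W # Vs) M"
proof (induction V and M arbitrary: k and k rule: val.induct comp.induct)
  case (Var i)
  then show ?case using assms
    by (auto simp: nth_Cons' not_less less_Suc_eq)
qed (use assms in auto)

lemma fv_psubst:
  assumes "\<forall>V \<in> set Vs. closed_val V"
  shows
  "fv_val V \<subseteq> {..<k + length Vs} \<Longrightarrow> fv_val (psubst_val k Vs V) \<subseteq> {..<k}"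
  "fv_comp M \<subseteq> {..<k + length Vs} \<Longrightarrow> fv_comp (psubst_comp k Vs M) \<subseteq> {..<k}"
proof (induction V and M arbitrary: k and k rule: val.induct comp.induct)
  case (Var i)
  then show ?case using assms by (auto simp: closed_val_def)
next
  case (Lam M)
  have "fv_comp M \<subseteq> {..<Suc k + length Vs}"
  proof
    fix i assume "i \<in> fv_comp M"
    with Lam.prems show "i \<in> {..<Suc k + length Vs}" by (cases i) auto
  qed
  from Lam.IH[OF this] show ?case by auto
qed auto

lemma closed_psubst:
  assumes "\<forall>V \<in> set Vs. closed_val V"
  shows "fv_val V \<subseteq> {..<length Vs} \<Longrightarrow> closed_val (psubst_val 0 Vs V)"
    and "fv_comp M \<subseteq> {..<length Vs} \<Longrightarrow> closed_comp (psubst_comp 0 Vs M)"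
  using fv_psubst[OF assms, where k = 0] by (auto simp: closed_val_def closed_comp_def)

lemma sem_list_closed: "list_all2 sem_V \<Gamma> Vs \<Longrightarrow> \<forall>V \<in> set Vs. closed_val V"
  by (induction rule: list_all2_induct) (auto dest: sem_closed)

text \<open>The \<open>\<omega>\<close> rules type open terms too; the bound on free variables makes
  every substituted term closed.\<close>

lemma typing_sound:
  "\<Gamma> \<turnstile>\<^sub>V V : \<delta> \<Longrightarrow> fv_val V \<subseteq> {..<length \<Gamma>} \<Longrightarrow> list_all2 sem_V \<Gamma> Vs \<Longrightarrow>
    sem_V \<delta> (psubst_val 0 Vs V)"
  "\<Gamma> \<turnstile>\<^sub>C M : \<tau> \<Longrightarrow> fv_comp M \<subseteq> {..<length \<Gamma>} \<Longrightarrow> list_all2 sem_V \<Gamma> Vs \<Longrightarrow>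
    sem_C \<tau> (psubst_comp 0 Vs M)"
proof (induction arbitrary: Vs and Vs rule: typing_V_typing_C.inducts)
  case (Ax i \<Gamma> \<delta>)
  then show ?case by (auto simp: list_all2_conv_all_nth)
next
  case (ArrI \<delta> \<Gamma> M \<tau>)
  note Vs = sem_list_closed[OF ArrI.prems(2)]
  have len: "length \<Gamma> = length Vs" using ArrI.prems(2) by (rule list_all2_lengthD)
  have fv: "fv_comp M \<subseteq> {..<length (\<delta> # \<Gamma>)}"
  proof
    fix i assume "i \<in> fv_comp M"
    with ArrI.prems(1) show "i \<in> {..<length (\<delta> # \<Gamma>)}" by (cases i) auto
  qed
  have cl: "closed_val (psubst_val 0 Vs (Lam M))"
    using closed_psubst(1)[OF Vs] ArrI.prems(1) len by metis
  have "sem_C \<tau> (Unit W \<star> psubst_val 0 Vs (Lam M))" if W: "sem_V \<delta> W" for W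
  \<comment> \<open>Expansion from the contractum to the redex.\<close>
  proof (rule sem_C_transfer)
    note clW = sem_closed(1)[OF W]
    show "closed_comp (Unit W \<star> psubst_val 0 Vs (Lam M))" using cl clW by simp
    have "sem_C \<tau> (psubst_comp 0 (W # Vs) M)"
      using ArrI.IH[OF fv] W ArrI.prems(2) by simp
    then show "sem_C \<tau> (subst_comp 0 W (psubst_comp (Suc 0) Vs M))"
      using subst_psubst(2)[of W Vs] Vs clW by simp
    show "Unit W \<star> psubst_val 0 Vs (Lam M) \<Down> U"
      if "subst_comp 0 W (psubst_comp (Suc 0) Vs M) \<Down> U" for U
      using that conv_bind[OF _ conv_unit[OF clW]] cl clW by simp
  qed
  with cl show ?case by simp
next
  case (UnitI \<Gamma> V \<delta>)
  then have "sem_V \<delta> (psubst_val 0 Vs V)" by simp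
  with sem_closed(1)[OF this] show ?case by (auto intro: conv_unit)
next
  case (ArrE \<Gamma> M \<delta> V \<tau>)
  let ?M = "psubst_comp 0 Vs M" and ?V = "psubst_val 0 Vs V"
  have "sem_C (T \<delta>) ?M" and V: "sem_V (\<delta> \<rightarrow> \<tau>) ?V"
    using ArrE by auto
  then obtain W where cl: "closed_comp ?M" and W: "?M \<Down> W" "sem_V \<delta> W" by auto
  have clV: "closed_val ?V" using V by simp
  then obtain N where N: "?V = Lam N" by (rule closed_val_cases)
  \<comment> \<open>The arrow predicate covers only \<open>Unit W \<star> ?V\<close>; since
    \<open>?M\<close> converges to \<open>W\<close>, the values reached carry over to
    \<open>?M \<star> ?V\<close>.\<close>
  have "sem_C \<tau> (?M \<star> ?V)"
  proof (rule sem_C_transfer)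
    show "closed_comp (?M \<star> ?V)" using cl clV by simp
    show "sem_C \<tau> (Unit W \<star> ?V)" using V W by simp
    show "?M \<star> ?V \<Down> U" if "Unit W \<star> ?V \<Down> U" for U
    proof -
      from that have "subst_comp 0 W N \<Down> U"
        unfolding N by (auto elim: converges_BindE converges_UnitE)
      with conv_bind[OF _ W(1)] cl clV show ?thesis unfolding N by simp
    qed
  qed
  then show ?case by simp
next
  case (OmegaV \<Gamma> V)
  then show ?case
    using closed_psubst(1)[OF sem_list_closed] list_all2_lengthD by (metis sem_V.simps(4))
next
  case (OmegaC \<Gamma> M)
  then show ?case
    using closed_psubst(2)[OF sem_list_closed] list_all2_lengthD by (metis sem_C.simps(3))
qed (auto intro: le_sound)

theorem mainTheorem2:
  fixes M :: comp
  assumes "closed_comp M"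
  shows "(\<exists>V. closed_val V \<and> M \<Down> V) \<longleftrightarrow> (\<exists>\<tau>. \<not> \<tau> =\<^sub>C \<omega>\<^sub>C \<and> [] \<turnstile>\<^sub>C M : \<tau>)"
proof
  assume "\<exists>V. closed_val V \<and> M \<Down> V"
  then obtain V where "M \<Down> V" by blast
  then have "[] \<turnstile>\<^sub>C M : T \<omega>\<^sub>V" using OmegaV by (rule subject_expansion)
  then show "\<exists>\<tau>. \<not> \<tau> =\<^sub>C \<omega>\<^sub>C \<and> [] \<turnstile>\<^sub>C M : \<tau>" using T_not_omega by blast
next
  assume "\<exists>\<tau>. \<not> \<tau> =\<^sub>C \<omega>\<^sub>C \<and> [] \<turnstile>\<^sub>C M : \<tau>"
  then obtain \<tau> where \<tau>: "\<not> \<tau> =\<^sub>C \<omega>\<^sub>C" and "[] \<turnstile>\<^sub>C M : \<tau>" by blast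
  then have "sem_C \<tau> (psubst_comp 0 [] M)"
    using assms by (intro typing_sound(2)) (auto simp: closed_comp_def)
  then have "sem_C \<tau> M" by (simp add: psubst_Nil)
  moreover have "\<not> \<omega>\<^sub>C \<le>\<^sub>C \<tau>" using \<tau> C_top by (auto simp: eq_C_def)
  ultimately obtain V where "M \<Down> V" using sem_C_converges by blast
  then show "\<exists>V. closed_val V \<and> M \<Down> V" using converges_closed_val by blast
qed

end
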